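(* Let $S_1,\dotsc,S_n\subseteq\mathbb{R}^d$ be closed Euclidean balls and $\Lambda\subseteq\mathbb{R}^d$ a lattice. Let $e_1,\dotsc,e_d$ be a basis of $\Lambda$, and for $0\leqslant i\leqslant d$ let $\Lambda^i$ be the $\mathbb{Z}$-span of $0,e_1,\dotsc,e_i$ (so $\Lambda^0=\{0\}$). Let $q_1\geqslant q_2\geqslant\dotsb\geqslant q_d\geqslant q_{d+1}$ be positive integers satisfying (C1) $\mathfrak{D}S_j\cap q_i(\Lambda\setminus\Lambda^{i-1})=\varnothing$ for all $1\leqslant j\leqslant n$ and $1\leqslant i\leqslant d$; (C2) $(S_j-S_k)\cap q_{d+1}\Lambda=\varnothing$ for all $1\leqslant j,k\leqslant n$ with $j\neq k$. Then \[\sum_{j=1}^{n}\lvert S_j\cap\Lambda\rvert\leqslant\prod_{i=1}^{d}q_i.\]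
   Context: A lattice is the $\mathbb{Z}$-span of a basis of $\mathbb{R}^d$. For $T\subseteq\mathbb{R}^d$, $\mathfrak{D}T:=T-T=\{x-y: x,y\in T\}$; for sets $A,B$, $A-B=\{a-b:a\in A,b\in B\}$; for a set $X$ and scalar $q$, $qX=\{qx:x\in X\}$; $\lvert T\rvert$ is cardinality. *)

theory Defs
  imports "HOL-Analysis.Analysis"
begin

text \<open>Every real vector space is a \<open>\<int>\<close>-module; this provides \<open>\<int>\<close>-spans and
  \<open>\<int>\<close>-linear independence.\<close>

global_interpretation int_module:
  module "\<lambda>(k::int) (x::'a::real_vector). of_int k *\<^sub>R x"
  defines zspan = int_module.span
    and zdependent = int_module.dependent
  by unfold_locales (auto simp: algebra_simps)

definition is_lattice :: "'a::euclidean_space set \<Rightarrow> bool" where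
  "is_lattice L \<longleftrightarrow> (\<exists>B. independent B \<and> span B = UNIV \<and> L = zspan B)"

text \<open>\<open>e 1, \<dots>, e d\<close> is a \<open>\<int>\<close>-basis of \<open>L\<close>. Injectivity is needed since
  \<open>zdependent\<close> speaks about the set of vectors only.\<close>

definition lattice_basis :: "nat \<Rightarrow> (nat \<Rightarrow> 'a::euclidean_space) \<Rightarrow> 'a set \<Rightarrow> bool" where
  "lattice_basis d e L \<longleftrightarrow>
     inj_on e {1..d} \<and> \<not> zdependent (e ` {1..d}) \<and> zspan (e ` {1..d}) = L"

definition is_closed_ball :: "'a::euclidean_space set \<Rightarrow> bool" where
  "is_closed_ball T \<longleftrightarrow> (\<exists>c r. 0 \<le> r \<and> T = cball c r)"

text \<open>The Minkowski difference; on sets, \<open>A - B\<close> is the set-theoretic difference.\<close>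

definition mdiff :: "'a::ab_group_add set \<Rightarrow> 'a set \<Rightarrow> 'a set" where
  "mdiff A B = {a - b | a b. a \<in> A \<and> b \<in> B}"

definition dilate :: "nat \<Rightarrow> 'a::real_vector set \<Rightarrow> 'a set" where
  "dilate q X = (\<lambda>x. real q *\<^sub>R x) ` X"

end

theory Submission
  imports Defs
begin

text \<open>Induction on \<open>d\<close>. First reduce to \<open>q\<^sub>d\<^sub>+\<^sub>1 = q\<^sub>d\<close>: let \<open>u\<^sub>j\<close> be a lattice point
  nearest to the centre of \<open>S\<^sub>j\<close> divided by \<open>q\<^sub>d\<^sub>+\<^sub>1\<close>, and translate \<open>S\<^sub>j\<close> by \<open>(q\<^sub>d - q\<^sub>d\<^sub>+\<^sub>1) u\<^sub>j\<close>.
  The nearest-point map is monotone, so the translated balls are disjoint modulo \<open>q\<^sub>d \<Lambda>\<close>.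
  Now cut the balls by the translates of \<open>span {e\<^sub>1, \<dots>, e\<^sub>d\<^sub>-\<^sub>1}\<close> by \<open>k e\<^sub>d\<close>, \<open>k \<in> \<int>\<close>. For \<open>k\<close> in a
  fixed residue class modulo \<open>q\<^sub>d\<close> the slices, moved back by \<open>k e\<^sub>d\<close>, are \<open>(d - 1)\<close>-dimensional
  balls, disjoint modulo \<open>q\<^sub>d \<Lambda>\<^sup>d\<^sup>-\<^sup>1\<close>: slices of different balls by the choice of the
  translations, slices of the same ball by (C1) for \<open>i = d\<close>. So the induction hypothesis
  applies to each of the \<open>q\<^sub>d\<close> classes.\<close>

section \<open>Integer spans of independent sets\<close>

lemma zspan_subset_span: "zspan B \<subseteq> span B"
proof
  fix x assume "x \<in> zspan B"
  then show "x \<in> span B"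
    by (induction rule: int_module.span_induct_alt) (auto intro: span_zero span_add span_scale span_base)
qed

lemma zspan_insert_iff:
  "x \<in> zspan (insert b B) \<longleftrightarrow> (\<exists>k::int. x - of_int k *\<^sub>R b \<in> zspan B)"
  by (simp add: int_module.span_insert)

text \<open>Makes the coefficient of \<open>b\<close> well defined: two different values would put a
  nonzero multiple of \<open>b\<close> into \<open>span B\<close>.\<close>

lemma span_height_unique:
  assumes "b \<notin> span B" "x - of_int k *\<^sub>R b \<in> span B" "x - of_int l *\<^sub>R b \<in> span B"
  shows "k = l"
proof (rule ccontr)
  assume "k \<noteq> l"
  have "(x - of_int l *\<^sub>R b) - (x - of_int k *\<^sub>R b) \<in> span B"
    using assms(2,3) span_diff by blast
  then have "(of_int k - of_int l) *\<^sub>R b \<in> span B" by (simp add: algebra_simps)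
  then have "(1 / (of_int k - of_int l)) *\<^sub>R ((of_int k - of_int l) *\<^sub>R b) \<in> span B"
    by (rule span_scale)
  with \<open>k \<noteq> l\<close> assms(1) show False by simp
qed

text \<open>Induction on \<open>B\<close>. The part \<open>z\<close> of \<open>b\<close> orthogonal
  to \<open>span B\<close> reads off the coefficient \<open>k\<close> of \<open>b\<close>, since
  \<open>z \<bullet> x = k * (z \<bullet> z)\<close>; so \<open>k\<close> is bounded on a ball, and
  for each \<open>k\<close> the points are translates of points of \<open>zspan B\<close> in another
  ball.\<close>

lemma finite_zspan_cball:
  fixes B :: "'a::euclidean_space set"
  assumes "independent B"
  shows "finite (zspan B \<inter> cball c r)"
proof -
  have "finite B" using assms by (rule independent_imp_finite)
  then show ?thesis using assms
  proof (induction B arbitrary: c)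
    case empty
    then show ?case by simp
  next
    case (insert b B)
    have bB: "b \<notin> span B" and iB: "independent B"
      using insert.prems insert.hyps by (auto simp: independent_insert)
    obtain y z where yz: "y \<in> span B" "\<And>w. w \<in> span B \<Longrightarrow> orthogonal z w" "b = y + z"
      using orthogonal_subspace_decomp_exists by metis
    have z0: "z \<noteq> 0" using yz bB by auto
    define N where "N = \<lceil>(norm c + r) / norm z\<rceil>"
    have "zspan (insert b B) \<inter> cball c r \<subseteq>
      (\<Union>k\<in>{-N..N}. (\<lambda>u. u + of_int k *\<^sub>R b) ` (zspan B \<inter> cball (c - of_int k *\<^sub>R b) r))"
    proof
      fix x assume x: "x \<in> zspan (insert b B) \<inter> cball c r"
      then obtain k where k: "x - of_int k *\<^sub>R b \<in> zspan B" by (auto simp: zspan_insert_iff)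
      have "z \<bullet> (x - of_int k *\<^sub>R b) = 0" "z \<bullet> y = 0"
        using k yz zspan_subset_span by (auto simp: orthogonal_def subset_iff)
      then have "z \<bullet> x = of_int k * (z \<bullet> z)"
        by (simp add: yz(3) algebra_simps)
      then have "\<bar>of_int k\<bar> * (norm z * norm z) = \<bar>z \<bullet> x\<bar>"
        by (simp add: abs_mult power2_norm_eq_inner flip: power2_eq_square)
      also have "\<dots> \<le> norm z * norm x" by (rule Cauchy_Schwarz_ineq2)
      finally have "\<bar>of_int k\<bar> * norm z \<le> norm x" using z0 by simp
      also have "\<dots> \<le> norm c + r" using x norm_triangle_ineq2[of x c]
        by (simp add: dist_norm norm_minus_commute)
      finally have "\<bar>of_int k\<bar> \<le> (norm c + r) / norm z" using z0 by (simp add: field_simps)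
      then have "\<bar>k\<bar> \<le> N" unfolding N_def by linarith
      moreover have "x - of_int k *\<^sub>R b \<in> cball (c - of_int k *\<^sub>R b) r"
        using x by (simp add: dist_norm)
      ultimately show "x \<in> (\<Union>k\<in>{-N..N}. (\<lambda>u. u + of_int k *\<^sub>R b) `
          (zspan B \<inter> cball (c - of_int k *\<^sub>R b) r))"
        using k by (intro UN_I[of k] image_eqI[of _ _ "x - of_int k *\<^sub>R b"]) auto
    qed
    then show ?case by (rule finite_subset) (use insert.IH[OF iB] in auto)
  qed
qed

text \<open>As \<open>0\<close> lies in the span, only the finitely many points within distance
  \<open>norm x\<close> of \<open>x\<close> compete.\<close>

lemma exists_nearest_zspan:
  fixes B :: "'a::euclidean_space set"
  assumes "independent B"
  shows "\<exists>u\<in>zspan B. \<forall>v\<in>zspan B. norm (x - u) \<le> norm (x - v)"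
proof -
  let ?A = "zspan B \<inter> cball x (norm x)"
  have fin: "finite ?A" and ne: "?A \<noteq> {}"
    using finite_zspan_cball[OF assms] int_module.span_zero[of B]
    by (auto simp: set_eq_iff intro!: exI[of _ 0])
  obtain u where u: "u \<in> ?A" "\<And>v. v \<in> ?A \<Longrightarrow> norm (x - u) \<le> norm (x - v)"
    using arg_min_if_finite[OF fin ne, of "\<lambda>v. norm (x - v)"] by (metis linorder_not_le)
  have "norm (x - u) \<le> norm (x - v)" if "v \<in> zspan B" for v
    using u that by (cases "v \<in> ?A") (auto simp: dist_norm)
  with u show ?thesis by auto
qed

section \<open>Monotonicity of nearest points\<close>

text \<open>Add the squared inequalities: all squares cancel and only the mixed products
  remain.\<close>

lemma nearest_point_monotone:
  fixes x y :: "'a::real_inner"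
  assumes "norm (x - v) \<le> norm (x - w)" "norm (y - w) \<le> norm (y - v)"
  shows "0 \<le> (x - y) \<bullet> (v - w)"
proof -
  have "(x - v) \<bullet> (x - v) \<le> (x - w) \<bullet> (x - w)" "(y - w) \<bullet> (y - w) \<le> (y - v) \<bullet> (y - v)"
    using assms by (auto simp: norm_le)
  then show ?thesis by (simp add: algebra_simps inner_commute)
qed

lemma norm_le_norm_add_monotone:
  fixes z w :: "'a::real_inner"
  assumes "0 \<le> z \<bullet> w" "0 \<le> t"
  shows "norm z \<le> norm (z + t *\<^sub>R w)"
  using assms by (simp add: norm_le algebra_simps inner_commute)

text \<open>Replaces the modulus \<open>p\<close> by a larger \<open>Q\<close>: moving a centre by \<open>Q - p\<close> times
  the lattice point nearest to its \<open>p\<close>-th part is a monotone perturbation of the identity,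
  so it does not decrease distances, and it turns \<open>p\<close>-periodicity into \<open>Q\<close>-periodicity.\<close>

lemma norm_le_change_modulus:
  fixes x y :: "'a::real_inner" and p Q :: real
  assumes p: "0 < p" "p \<le> Q"
    and u: "\<forall>v\<in>zspan B. norm (x /\<^sub>R p - u) \<le> norm (x /\<^sub>R p - v)" "u \<in> zspan B"
    and w: "\<forall>v\<in>zspan B. norm (y /\<^sub>R p - w) \<le> norm (y /\<^sub>R p - v)" "w \<in> zspan B"
    and v: "v \<in> zspan B"
  shows "norm (x - y - p *\<^sub>R v) \<le>
    norm ((x + (Q - p) *\<^sub>R u) - (y + (Q - p) *\<^sub>R w) - Q *\<^sub>R v)"
proof -
  have "norm (x /\<^sub>R p - u) \<le> norm (x /\<^sub>R p - (w + v))"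
    using u w v by (auto intro: int_module.span_add)
  \<comment> \<open>By translation invariance of \<open>zspan B\<close>, the point
    \<open>w + v\<close> is nearest to \<open>y /\<^sub>R p + v\<close>.\<close>
  moreover have "norm ((y /\<^sub>R p + v) - (w + v)) \<le> norm ((y /\<^sub>R p + v) - u)"
    using w(1)[rule_format, of "u - v"] u v by (auto intro: int_module.span_diff simp: algebra_simps)
  ultimately have "0 \<le> (x /\<^sub>R p - (y /\<^sub>R p + v)) \<bullet> (u - (w + v))"
    by (rule nearest_point_monotone)
  then have "0 \<le> p * ((x /\<^sub>R p - (y /\<^sub>R p + v)) \<bullet> (u - (w + v)))" using p by simp
  also have "\<dots> = (p *\<^sub>R (x /\<^sub>R p - (y /\<^sub>R p + v))) \<bullet> (u - (w + v))" by simp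
  also have "p *\<^sub>R (x /\<^sub>R p - (y /\<^sub>R p + v)) = x - y - p *\<^sub>R v"
    using p by (simp add: algebra_simps)
  finally have "norm (x - y - p *\<^sub>R v) \<le> norm (x - y - p *\<^sub>R v + (Q - p) *\<^sub>R (u - (w + v)))"
    using p by (intro norm_le_norm_add_monotone) auto
  then show ?thesis by (simp add: algebra_simps)
qed

section \<open>Balls inside a subspace\<close>

text \<open>Turns a bound on the centres back into points of the balls: the defect
  \<open>c - c' - z\<close> is shared between the two centres in the ratio \<open>r : r'\<close>.
  Two zero radii are treated apart because the ratio is then undefined.\<close>

lemma exists_cball_points_with_difference:
  fixes c c' z :: "'a::real_normed_vector"
  assumes "subspace V" "c \<in> V" "c' \<in> V" "z \<in> V" "0 \<le> r" "0 \<le> r'"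
    and le: "norm (c - c' - z) \<le> r + r'"
  shows "\<exists>x\<in>V \<inter> cball c r. \<exists>y\<in>V \<inter> cball c' r'. x - y = z"
proof (cases "r + r' = 0")
  case True
  then have "r = 0" "r' = 0" using assms by auto
  then have "c - c' = z" using le by (simp add: algebra_simps)
  then have "c \<in> V \<inter> cball c r" "c' \<in> V \<inter> cball c' r'" using assms by auto
  with \<open>c - c' = z\<close> show ?thesis by blast
next
  case False
  define s where "s = r / (r + r')"
  define D where "D = c - c' - z"
  have s: "0 \<le> s" "0 \<le> 1 - s" "s * (r + r') = r" "(1 - s) * (r + r') = r'"
    using False assms(5,6) by (auto simp: s_def field_simps)
  have DV: "D \<in> V" unfolding D_def using assms by (auto intro: subspace_diff)
  have "norm (s *\<^sub>R D) \<le> r" "norm ((1 - s) *\<^sub>R D) \<le> r'"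
    using s le mult_left_mono[OF le s(1)] mult_left_mono[OF le s(2)] by (auto simp: D_def)
  then have "c - s *\<^sub>R D \<in> V \<inter> cball c r" "c' + (1 - s) *\<^sub>R D \<in> V \<inter> cball c' r'"
    using assms DV by (auto simp: dist_norm intro: subspace_diff subspace_add subspace_scale)
  moreover have "(c - s *\<^sub>R D) - (c' + (1 - s) *\<^sub>R D) = z"
    by (simp add: algebra_simps D_def)
  ultimately show ?thesis by blast
qed

text \<open>By Pythagoras the new centre is the orthogonal projection of \<open>z\<close> to
  \<open>V\<close>. The radius may be negative, so that an empty slice is also a ball centred in
  \<open>V\<close>.\<close>

lemma subspace_slice_cball:
  fixes z :: "'a::euclidean_space"
  assumes "subspace V"
  shows "\<exists>c\<in>V. \<exists>\<rho>. V \<inter> cball z r = V \<inter> cball c \<rho>"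
proof -
  obtain c t where ct: "c \<in> span V" "\<And>w. w \<in> span V \<Longrightarrow> orthogonal t w" "z = c + t"
    using orthogonal_subspace_decomp_exists by metis
  have cV: "c \<in> V" using ct assms by (simp add: span_eq_iff[THEN iffD2])
  have pyth: "(norm (z - x))\<^sup>2 = (norm (c - x))\<^sup>2 + (norm t)\<^sup>2" if "x \<in> V" for x
  proof -
    have "orthogonal t (c - x)" using that cV assms by (intro ct(2) span_base subspace_diff)
    then have "t \<bullet> (c - x) = 0" by (simp add: orthogonal_def)
    moreover have "z - x = (c - x) + t" using ct by simp
    ultimately show ?thesis
      by (simp only: power2_norm_eq_inner inner_add_left inner_add_right inner_commute)
  qed
  show ?thesis
  proof (cases "norm t \<le> r")
    case False
    have "norm t \<le> norm (z - x)" if "x \<in> V" for x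
      by (rule power2_le_imp_le) (use pyth[OF that] in simp_all)
    then have "V \<inter> cball z r = V \<inter> cball c (-1)" using False by (force simp: dist_norm)
    with cV show ?thesis by blast
  next
    case True
    have r0: "0 \<le> r" using True norm_ge_zero order_trans by blast
    have "norm (z - x) \<le> r \<longleftrightarrow> norm (c - x) \<le> sqrt (r\<^sup>2 - (norm t)\<^sup>2)" if "x \<in> V" for x
    proof -
      have "norm (z - x) \<le> r \<longleftrightarrow> (norm (z - x))\<^sup>2 \<le> r\<^sup>2"
        using r0 by (simp add: abs_le_square_iff[symmetric])
      also have "\<dots> \<longleftrightarrow> (norm (c - x))\<^sup>2 \<le> r\<^sup>2 - (norm t)\<^sup>2" using pyth[OF that] by linarith
      also have "\<dots> \<longleftrightarrow> norm (c - x) \<le> sqrt (r\<^sup>2 - (norm t)\<^sup>2)"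
        by (metis norm_ge_zero real_le_rsqrt real_sqrt_le_iff real_sqrt_abs abs_norm_cancel)
      finally show ?thesis .
    qed
    then have "V \<inter> cball z r = V \<inter> cball c (sqrt (r\<^sup>2 - (norm t)\<^sup>2))" by (auto simp: dist_norm)
    with cV show ?thesis by blast
  qed
qed

section \<open>The induction on \<open>d\<close>\<close>

text \<open>Indices are lists, so that the slice of ball \<open>js\<close> at height \<open>k\<close> can be indexed by
  \<open>k # js\<close> without leaving the type.\<close>

lemma sum_card_lattice_balls_le_prod:
  fixes e :: "nat \<Rightarrow> 'a::euclidean_space" and q :: "nat \<Rightarrow> nat"
    and J :: "int list set" and c :: "int list \<Rightarrow> 'a"
  assumes "inj_on e {1..d}" "independent (e ` {1..d})" "finite J"
    and "\<And>j. j \<in> J \<Longrightarrow> c j \<in> span (e ` {1..d})"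
    and "\<And>i. i \<in> {1..d + 1} \<Longrightarrow> 0 < q i"
    and "\<And>i. i \<in> {1..d} \<Longrightarrow> q (i + 1) \<le> q i"
    and "\<And>i j x y v. \<lbrakk>i \<in> {1..d}; j \<in> J;
      x \<in> span (e ` {1..d}) \<inter> cball (c j) (r j); y \<in> span (e ` {1..d}) \<inter> cball (c j) (r j);
      v \<in> zspan (e ` {1..d}); x - y = real (q i) *\<^sub>R v\<rbrakk> \<Longrightarrow> v \<in> zspan (e ` {1..i - 1})"
    and "\<And>j k x y v. \<lbrakk>j \<in> J; k \<in> J; j \<noteq> k;
      x \<in> span (e ` {1..d}) \<inter> cball (c j) (r j); y \<in> span (e ` {1..d}) \<inter> cball (c k) (r k);
      v \<in> zspan (e ` {1..d})\<rbrakk> \<Longrightarrow> x - y \<noteq> real (q (d + 1)) *\<^sub>R v"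
  shows "(\<Sum>j\<in>J. card (zspan (e ` {1..d}) \<inter> cball (c j) (r j))) \<le> (\<Prod>i = 1..d. q i)"
  using assms
proof (induction d arbitrary: J c r)
  case 0
  \<comment> \<open>Empty slices reach this case as balls of negative radius, which count
    \<open>0\<close>. Two nonempty balls would share the origin, against the last assumption with
    \<open>v = 0\<close>.\<close>
  let ?J = "{j \<in> J. 0 \<le> r j}"
  have c0: "c j = 0" if "j \<in> J" for j using 0(4)[OF that] by simp
  have "j = k" if "j \<in> ?J" "k \<in> ?J" for j k
    using 0(8)[of j k 0 0 0] that c0 by auto
  then have "card ?J \<le> 1" using \<open>finite J\<close> by (auto simp: card_le_Suc0_iff_eq)
  moreover have "card (zspan (e ` {1..0}) \<inter> cball (c j) (r j)) = (if 0 \<le> r j then 1 else 0)"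
    if "j \<in> J" for j
    using c0[OF that] by (auto simp: card_eq_0_iff)
  then have "(\<Sum>j\<in>J. card (zspan (e ` {1..0}) \<inter> cball (c j) (r j))) = card ?J"
    using \<open>finite J\<close> by (simp add: sum.If_cases Int_def)
  ultimately show ?case by simp
next
  case (Suc d)
  define b where "b = e (Suc d)"
  define V' where "V' = span (e ` {1..d})"
  define L' where "L' = zspan (e ` {1..d})"
  define V where "V = span (e ` {1..Suc d})"
  define L where "L = zspan (e ` {1..Suc d})"
  define p where "p = q (Suc d + 1)"
  define Q where "Q = q (Suc d)"
  have ins: "e ` {1..Suc d} = insert b (e ` {1..d})"
    by (simp add: atLeastAtMostSuc_conv b_def)
  have bn: "b \<notin> e ` {1..d}"
    using inj_onD[OF Suc.prems(1), of "Suc d"] by (fastforce simp: b_def)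
  have bV': "b \<notin> V'" and indep': "independent (e ` {1..d})"
    using Suc.prems(2) bn unfolding ins V'_def by (auto simp: independent_insert)
  have inj': "inj_on e {1..d}" using Suc.prems(1) by (rule inj_on_subset) auto
  have L_iff: "x \<in> L \<longleftrightarrow> (\<exists>k::int. x - of_int k *\<^sub>R b \<in> L')" for x
    unfolding L_def L'_def ins by (rule zspan_insert_iff)
  have LV: "L \<subseteq> V" "L' \<subseteq> V'" unfolding L_def V_def L'_def V'_def by (simp_all add: zspan_subset_span)
  have bL: "b \<in> L" unfolding L_def ins by (simp add: int_module.span_base)
  have L'L: "L' \<subseteq> L" and V'V: "V' \<subseteq> V" unfolding L_def L'_def V_def V'_def ins
    by (auto intro: int_module.span_mono[THEN subsetD] span_mono[THEN subsetD])
  have Ladd: "x + y \<in> L" and Ldiff: "x - y \<in> L" if "x \<in> L" "y \<in> L" for x y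
    using that unfolding L_def by (auto intro: int_module.span_add int_module.span_diff)
  have Lint: "of_int k *\<^sub>R x \<in> L" if "x \<in> L" for k x
    using that unfolding L_def by (rule int_module.span_scale)
  have subV: "subspace V" "subspace V'" unfolding V_def V'_def by auto
  have p0: "0 < p" and Q0: "0 < Q" and pQ: "p \<le> Q"
    using Suc.prems(5)[of "Suc d + 1"] Suc.prems(5)[of "Suc d"] Suc.prems(6)[of "Suc d"]
    by (auto simp: p_def Q_def)
  have cV: "c j \<in> V" if "j \<in> J" for j using Suc.prems(4) that by (simp add: V_def)
  have C1: "v \<in> zspan (e ` {1..i - 1})" if "i \<in> {1..Suc d}" "j \<in> J"
      "x \<in> V \<inter> cball (c j) (r j)" "y \<in> V \<inter> cball (c j) (r j)" "v \<in> L" "x - y = real (q i) *\<^sub>R v"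
    for i j x y v
    using Suc.prems(7) that unfolding V_def L_def by blast
  have C2: "x - y \<noteq> real p *\<^sub>R v" if "j \<in> J" "k \<in> J" "j \<noteq> k"
      "x \<in> V \<inter> cball (c j) (r j)" "y \<in> V \<inter> cball (c k) (r k)" "v \<in> L" for j k x y v
    using Suc.prems(8) that unfolding V_def L_def p_def by blast

  \<comment> \<open>Translation of the balls to the modulus \<open>Q\<close>\<close>
  have "\<forall>j. \<exists>w. w \<in> L \<and> (\<forall>v\<in>L. norm (c j /\<^sub>R real p - w) \<le> norm (c j /\<^sub>R real p - v))"
    using exists_nearest_zspan[OF Suc.prems(2)] unfolding L_def by blast
  then obtain u where uL: "\<And>j. u j \<in> L"
    and u: "\<And>j. \<forall>v\<in>L. norm (c j /\<^sub>R real p - u j) \<le> norm (c j /\<^sub>R real p - v)"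
    by metis
  \<comment> \<open>\<open>Q - p\<close> is an integer, so \<open>s j\<close> is a lattice vector:
    the translation keeps the number of lattice points and all differences within one ball.\<close>
  define s where "s j = (real Q - real p) *\<^sub>R u j" for j
  define c1 where "c1 j = c j + s j" for j
  have sL: "s j \<in> L" for j using Lint[OF uL, of "int Q - int p"] by (simp add: s_def)
  have shift: "x - s j \<in> V \<inter> cball (c j) (r j)" if "x \<in> V \<inter> cball (c1 j) (r j)" for x j
    using that sL LV subV by (auto simp: c1_def dist_norm algebra_simps intro: subspace_diff)
  have D1: "v \<in> zspan (e ` {1..i - 1})" if "i \<in> {1..Suc d}" "j \<in> J"
      "x \<in> V \<inter> cball (c1 j) (r j)" "y \<in> V \<inter> cball (c1 j) (r j)" "v \<in> L" "x - y = real (q i) *\<^sub>R v"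
    for i j x y v
    using C1[OF that(1,2) shift[OF that(3)] shift[OF that(4)] that(5)] that(6) by simp
  have D2: "x - y \<noteq> real Q *\<^sub>R v" if jk: "j \<in> J" "k \<in> J" "j \<noteq> k" and
      x: "x \<in> V \<inter> cball (c1 j) (r j)" and y: "y \<in> V \<inter> cball (c1 k) (r k)" and v: "v \<in> L" for j k x y v
  proof
    assume eq: "x - y = real Q *\<^sub>R v"
    have r0: "0 \<le> r j" "0 \<le> r k" using x y by (auto intro: order_trans[OF zero_le_dist])
    \<comment> \<open>The argument passes through the centres: \<open>x\<close> and \<open>y\<close>
      bound the distance for the translated centres by \<open>r j + r k\<close>, hence that for the
      original ones with \<open>p\<close> in place of \<open>Q\<close>, and this yields points that
      contradict \<open>C2\<close>.\<close>
    have "norm (c j - c k - real p *\<^sub>R v) \<le> norm (c1 j - c1 k - real Q *\<^sub>R v)"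
      unfolding c1_def s_def
      by (rule norm_le_change_modulus[where B = "e ` {1..Suc d}", folded L_def])
        (use p0 pQ u uL v in auto)
    also have "\<dots> = norm ((c1 j - x) - (c1 k - y))" by (simp add: eq[symmetric] algebra_simps)
    also have "\<dots> \<le> norm (c1 j - x) + norm (c1 k - y)" by (rule norm_triangle_ineq4)
    also have "\<dots> \<le> r j + r k" using x y by (simp add: dist_norm add_mono)
    finally have "\<exists>x\<in>V \<inter> cball (c j) (r j). \<exists>y\<in>V \<inter> cball (c k) (r k). x - y = real p *\<^sub>R v"
      using v LV jk cV r0 subV by (intro exists_cball_points_with_difference) (auto intro: subspace_scale)
    then show False using C2 jk v by blast
  qed

  define A where "A j = L \<inter> cball (c1 j) (r j)" for j
  have finA: "finite (A j)" for j
    unfolding A_def L_def by (rule finite_zspan_cball[OF Suc.prems(2)])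
  have card_A: "card (L \<inter> cball (c j) (r j)) = card (A j)" for j
  proof (rule bij_betw_same_card)
    show "bij_betw (\<lambda>x. x + s j) (L \<inter> cball (c j) (r j)) (A j)"
      by (rule bij_betw_byWitness[where f' = "\<lambda>x. x - s j"])
        (auto simp: A_def c1_def dist_norm algebra_simps intro: Ladd Ldiff sL)
  qed

  \<comment> \<open>Slices by height\<close>
  \<comment> \<open>On \<open>L\<close>, \<open>h\<close> is the coordinate along the last basis
    vector \<open>b\<close>.\<close>
  obtain h :: "'a \<Rightarrow> int" where h: "\<And>x. x \<in> L \<Longrightarrow> x - of_int (h x) *\<^sub>R b \<in> L'"
    using L_iff by metis
  have h_unique: "h x = k" if "x - of_int k *\<^sub>R b \<in> L'" for x k
  proof (rule span_height_unique[of b "e ` {1..d}" x])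
    have "x \<in> L" using that L_iff by blast
    then show "x - of_int (h x) *\<^sub>R b \<in> span (e ` {1..d})" using h LV unfolding V'_def by blast
    show "x - of_int k *\<^sub>R b \<in> span (e ` {1..d})" using that LV unfolding V'_def by blast
  qed (use bV' in \<open>simp add: V'_def\<close>)

  \<comment> \<open>In an index \<open>l = k # j\<close>, the head is the height and the tail the
    index of the ball that is cut; subtracting \<open>k\<close> times \<open>b\<close> moves the
    slice into \<open>V'\<close>.\<close>
  have "\<exists>c' \<rho>. c' \<in> V' \<and> V' \<inter> cball (c1 (tl l) - of_int (hd l) *\<^sub>R b) (r (tl l)) = V' \<inter> cball c' \<rho>" for l
    using subspace_slice_cball[OF subV(2)] by blast
  then obtain c' r' where c'V: "\<And>l. c' l \<in> V'"
    and slice0: "\<And>l. V' \<inter> cball (c1 (tl l) - of_int (hd l) *\<^sub>R b) (r (tl l)) = V' \<inter> cball (c' l) (r' l)"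
    by metis
  have slice: "x \<in> V' \<inter> cball (c' (k # j)) (r' (k # j)) \<longleftrightarrow>
      x \<in> V' \<and> x + of_int k *\<^sub>R b \<in> cball (c1 j) (r j)" for x k j
    using slice0[of "k # j"] by (auto simp: dist_norm algebra_simps set_eq_iff)
  have lift: "x + of_int k *\<^sub>R b \<in> V \<inter> cball (c1 j) (r j)"
    if "x \<in> V' \<inter> cball (c' (k # j)) (r' (k # j))" for x k j
    using that V'V bL LV subV unfolding slice by (auto intro!: subspace_add subspace_scale)
  define w where "w l = card (L' \<inter> cball (c' l) (r' l))" for l
  have w: "w (k # j) = card {x \<in> A j. h x = k}" for k j
    unfolding w_def
  proof (rule bij_betw_same_card)
    show "bij_betw (\<lambda>x. x + of_int k *\<^sub>R b) (L' \<inter> cball (c' (k # j)) (r' (k # j))) {x \<in> A j. h x = k}"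
    proof (rule bij_betw_byWitness[where f' = "\<lambda>x. x - of_int k *\<^sub>R b"])
      show "(\<lambda>x. x + of_int k *\<^sub>R b) ` (L' \<inter> cball (c' (k # j)) (r' (k # j))) \<subseteq> {x \<in> A j. h x = k}"
      proof clarify
        fix x assume x: "x \<in> L'" "x \<in> cball (c' (k # j)) (r' (k # j))"
        then have "x + of_int k *\<^sub>R b \<in> cball (c1 j) (r j)" using slice LV by blast
        moreover have "x + of_int k *\<^sub>R b \<in> L" using x L'L Lint[OF bL] by (auto intro: Ladd)
        moreover have "h (x + of_int k *\<^sub>R b) = k" by (rule h_unique) (use x in simp)
        ultimately show "x + of_int k *\<^sub>R b \<in> A j \<and> h (x + of_int k *\<^sub>R b) = k" by (simp add: A_def)
      qed
      show "(\<lambda>x. x - of_int k *\<^sub>R b) ` {x \<in> A j. h x = k} \<subseteq> L' \<inter> cball (c' (k # j)) (r' (k # j))"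
      proof clarify
        fix x assume x: "x \<in> A j" "k = h x"
        then have "x - of_int k *\<^sub>R b \<in> L'" using h by (simp add: A_def)
        moreover from this have "x - of_int k *\<^sub>R b \<in> V' \<inter> cball (c' (k # j)) (r' (k # j))"
          unfolding slice using x LV by (auto simp: A_def)
        ultimately show "x - of_int (h x) *\<^sub>R b \<in> L' \<inter> cball (c' (h x # j)) (r' (h x # j))"
          using x by simp
      qed
    qed auto
  qed

  \<comment> \<open>Counting by residue classes of heights\<close>
  \<comment> \<open>One finite set of heights serves all balls, so that the indices form a product;
    a slice without lattice points adds \<open>0\<close>.\<close>
  define K where "K = (\<Union>j\<in>J. h ` A j)"
  have finK: "finite K" unfolding K_def using Suc.prems(3) finA by auto
  have sumA: "card (A j) = (\<Sum>k\<in>K. w (k # j))" if "j \<in> J" for j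
  proof -
    have "h ` A j \<subseteq> K" using that by (auto simp: K_def)
    then show ?thesis using sum.group[OF finA finK, of h j "\<lambda>_. 1::nat"] by (simp add: w)
  qed
  define I where "I = (\<lambda>(k, j). k # j) ` (K \<times> J)"
  have finI: "finite I" unfolding I_def using finK Suc.prems(3) by simp
  have "(\<Sum>j\<in>J. card (L \<inter> cball (c j) (r j))) = (\<Sum>j\<in>J. \<Sum>k\<in>K. w (k # j))"
    using sumA by (simp add: card_A)
  also have "\<dots> = (\<Sum>(k, j)\<in>K \<times> J. w (k # j))"
    by (subst sum.swap) (simp add: sum.cartesian_product)
  also have "\<dots> = sum w I"
    unfolding I_def by (subst sum.reindex) (auto simp: inj_on_def case_prod_unfold)
  also have "\<dots> = (\<Sum>g\<in>{0..<int Q}. \<Sum>l\<in>{l \<in> I. hd l mod int Q = g}. w l)"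
    using Q0 finI by (intro sum.group[symmetric]) auto
  also have "\<dots> \<le> (\<Sum>g\<in>{0..<int Q}. \<Prod>i = 1..d. q i)"
  proof (rule sum_mono)
    fix g
    let ?I = "{l \<in> I. hd l mod int Q = g}"
    have I_cases: "\<exists>k j. l = k # j \<and> j \<in> J \<and> k mod int Q = g" if "l \<in> ?I" for l
      using that by (auto simp: I_def)
    have E1: "v \<in> zspan (e ` {1..i - 1})" if i: "i \<in> {1..d}" and l: "l \<in> ?I"
      and xy: "x \<in> V' \<inter> cball (c' l) (r' l)" "y \<in> V' \<inter> cball (c' l) (r' l)"
      and v: "v \<in> L'" "x - y = real (q i) *\<^sub>R v" for i l x y v
    proof -
      obtain k j where kj: "l = k # j" "j \<in> J" using I_cases[OF l] by blast
      show ?thesis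
        \<comment> \<open>Both points are lifted by the same multiple of \<open>b\<close>, which
          leaves their difference unchanged.\<close>
        by (rule D1[of i j "x + of_int k *\<^sub>R b" "y + of_int k *\<^sub>R b"])
          (use i xy v lift kj L'L in auto)
    qed
    have E2: "x - y \<noteq> real Q *\<^sub>R v" if l: "l \<in> ?I" "l' \<in> ?I" "l \<noteq> l'"
      and xy: "x \<in> V' \<inter> cball (c' l) (r' l)" "y \<in> V' \<inter> cball (c' l') (r' l')"
      and v: "v \<in> L'" for l l' x y v
    proof
      assume eq: "x - y = real Q *\<^sub>R v"
      obtain k j where lk: "l = k # j" "j \<in> J" "k mod int Q = g" using I_cases[OF l(1)] by blast
      obtain k' j' where lk': "l' = k' # j'" "j' \<in> J" "k' mod int Q = g" using I_cases[OF l(2)] by blast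
      \<comment> \<open>Heights in one class differ by a multiple of \<open>Q\<close>, so their
        difference is absorbed into the lattice vector \<open>?v\<close>.\<close>
      obtain m where m: "k - k' = int Q * m" using lk lk' by (metis mod_eq_dvd_iff dvdE)
      let ?v = "v + of_int m *\<^sub>R b"
      have vL: "?v \<in> L" using v L'L bL by (auto intro: Ladd Lint)
      have "of_int k = of_int k' + real Q * of_int m"
        using arg_cong[OF m, of real_of_int] by simp
      then have eq': "(x + of_int k *\<^sub>R b) - (y + of_int k' *\<^sub>R b) = real Q *\<^sub>R ?v"
        using eq by (simp add: algebra_simps)
      have lx: "x + of_int k *\<^sub>R b \<in> V \<inter> cball (c1 j) (r j)"
        and ly: "y + of_int k' *\<^sub>R b \<in> V \<inter> cball (c1 j') (r j')"
        using lift xy lk lk' by auto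
      show False
      proof (cases "j = j'")
        case False
        then show ?thesis using D2[OF lk(2) lk'(2) _ lx ly vL] eq' by blast
      next
        case True
        \<comment> \<open>Condition (C1) at the top index forces the \<open>b\<close>-coordinate
          \<open>m\<close> of \<open>?v\<close> to vanish, so both slices are the same one.\<close>
        have "?v \<in> L'"
          using D1[of "Suc d" j, OF _ lk(2) lx _ vL] ly eq' True by (simp add: L'_def Q_def)
        then have "h ?v = 0" by (intro h_unique) simp
        moreover have "h ?v = m" by (intro h_unique) (use v in simp)
        ultimately have "k = k'" using m by simp
        with True l lk lk' show ?thesis by simp
      qed
    qed
    show "sum w ?I \<le> (\<Prod>i = 1..d. q i)"
      unfolding w_def L'_def
    \<comment> \<open>The last modulus in the induction hypothesis is \<open>q (d + 1)\<close>,
      which is exactly \<open>Q\<close>; hence \<open>E2\<close> supplies its disjointness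
      condition.\<close>
    proof (rule Suc.IH)
      show "c' j \<in> span (e ` {1..d})" for j using c'V unfolding V'_def .
      show "0 < q i" if "i \<in> {1..d + 1}" for i using Suc.prems(5) that by simp
      show "q (i + 1) \<le> q i" if "i \<in> {1..d}" for i using Suc.prems(6) that by simp
    qed (use inj' indep' finI E1 E2 in \<open>auto simp: V'_def L'_def Q_def\<close>)
  qed
  also have "\<dots> = (\<Prod>i = 1..Suc d. q i)" by (simp add: Q_def mult.commute)
  finally show ?case unfolding L_def .
qed

section \<open>Transfer to closed balls in the whole space\<close>

theorem theorem3:
  fixes S :: "nat \<Rightarrow> (real ^ 'd) set"
    and \<Lambda> :: "(real ^ 'd) set"
    and e :: "nat \<Rightarrow> real ^ 'd"
    and q :: "nat \<Rightarrow> nat"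
    and n d :: nat
  assumes d: "d = CARD('d)"
    and balls: "\<And>j. j \<in> {1..n} \<Longrightarrow> is_closed_ball (S j)"
    and lattice: "is_lattice \<Lambda>"
    and basis: "lattice_basis d e \<Lambda>"
    and q_pos: "\<And>i. i \<in> {1..d + 1} \<Longrightarrow> 0 < q i"
    and q_decr: "\<And>i. i \<in> {1..d} \<Longrightarrow> q (i + 1) \<le> q i"
    and C1: "\<And>i j. i \<in> {1..d} \<Longrightarrow> j \<in> {1..n} \<Longrightarrow>
      mdiff (S j) (S j) \<inter> dilate (q i) (\<Lambda> - zspan (insert 0 (e ` {1..i - 1}))) = {}"
    and C2: "\<And>j k. j \<in> {1..n} \<Longrightarrow> k \<in> {1..n} \<Longrightarrow> j \<noteq> k \<Longrightarrow>
      mdiff (S j) (S k) \<inter> dilate (q (d + 1)) \<Lambda> = {}"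
  shows "(\<Sum>j = 1..n. card (S j \<inter> \<Lambda>)) \<le> (\<Prod>i = 1..d. q i)"
proof -
  have inj: "inj_on e {1..d}" and L: "zspan (e ` {1..d}) = \<Lambda>"
    using basis by (auto simp: lattice_basis_def)
  obtain B where B: "span B = UNIV" "\<Lambda> = zspan B"
    using lattice by (auto simp: is_lattice_def)
  \<comment> \<open>Real independence of the basis is not implied by independence over the integers
    alone; it follows because \<open>d\<close> distinct vectors spanning a
    \<open>d\<close>-dimensional space are independent.\<close>
  have "B \<subseteq> span (e ` {1..d})"
    using B L zspan_subset_span int_module.span_superset by (metis order_trans)
  then have span_e: "span (e ` {1..d}) = UNIV"
    using B span_minimal[of B "span (e ` {1..d})"] by auto
  have indep: "independent (e ` {1..d})"
    by (rule card_le_dim_spanning[where V = UNIV]) (use span_e inj d in \<open>auto simp: card_image\<close>)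
  obtain c r where S: "\<And>j. j \<in> {1..n} \<Longrightarrow> S j = cball (c j) (r j)"
    using balls unfolding is_closed_ball_def by metis
  \<comment> \<open>One-element lists encode the ball numbers in the index type of the induction;
    \<open>f\<close> decodes them.\<close>
  define J where "J = (\<lambda>j. [int j]) ` {1..n}"
  define f where "f l = nat (hd l)" for l :: "int list"
  have fJ: "f l \<in> {1..n}" and inj_f: "l \<in> J \<Longrightarrow> l' \<in> J \<Longrightarrow> l \<noteq> l' \<Longrightarrow> f l \<noteq> f l'" if "l \<in> J" for l l'
    using that by (auto simp: J_def f_def)
  have "(\<Sum>j = 1..n. card (S j \<inter> \<Lambda>)) = (\<Sum>l\<in>J. card (zspan (e ` {1..d}) \<inter> cball (c (f l)) (r (f l))))"
    unfolding J_def by (subst sum.reindex) (auto simp del: One_nat_def simp: inj_on_def f_def S L Int_commute)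
  also have "\<dots> \<le> (\<Prod>i = 1..d. q i)"
  proof (rule sum_card_lattice_balls_le_prod[OF inj indep])
    fix i l x y v
    assume a: "i \<in> {1..d}" "l \<in> J" "x \<in> span (e ` {1..d}) \<inter> cball (c (f l)) (r (f l))"
      "y \<in> span (e ` {1..d}) \<inter> cball (c (f l)) (r (f l))" "v \<in> zspan (e ` {1..d})"
      "x - y = real (q i) *\<^sub>R v"
    then have "x - y \<in> mdiff (S (f l)) (S (f l))" using S[OF fJ] unfolding mdiff_def by blast
    then show "v \<in> zspan (e ` {1..i - 1})"
      using C1[OF a(1) fJ[OF a(2)]] a(5,6) L by (auto simp: dilate_def int_module.span_insert)
  next
    fix l l' x y v
    assume a: "l \<in> J" "l' \<in> J" "l \<noteq> l'" "x \<in> span (e ` {1..d}) \<inter> cball (c (f l)) (r (f l))"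
      "y \<in> span (e ` {1..d}) \<inter> cball (c (f l')) (r (f l'))" "v \<in> zspan (e ` {1..d})"
    then have "x - y \<in> mdiff (S (f l)) (S (f l'))" using S[OF fJ] unfolding mdiff_def by blast
    then show "x - y \<noteq> real (q (d + 1)) *\<^sub>R v"
      using C2[OF fJ[OF a(1)] fJ[OF a(2)] inj_f[OF a(1) a(1,2,3)]] a(6) L by (auto simp: dilate_def)
  qed (use q_pos q_decr span_e in \<open>auto simp: J_def\<close>)
  finally show ?thesis .
qed

end
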